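(* Let $X,Y\ge 0$ be unsigned (finite) sets, let $A\subset X$ and $B\subset X$, and let $\phi:Y\Rrightarrow X\setminus A$ and $\psi:X\setminus B\Rrightarrow Y$ be matchings. Then $$h=(\operatorname{id}(A)+\operatorname{create}(\phi))\triangleleft(\operatorname{id}(B)-\operatorname{create}(\psi)): A\Rrightarrow B$$ is a matching, and for every $a\in A$ $$h(a)=\operatorname{nestuntil}(\lambda x.\,x\in B,\ \lambda x.\,\phi(\psi(x)))(a).$$
   Context: A matching is a bijection between finite sets, written $P\Rrightarrow Q$. $X+Y$ denotes disjoint union of sets, treated as strictly commutative and associative by the usual identifications. For a test and a function $f$, $\operatorname{nestuntil}(\mathrm{test},f)=\lambda x.\ \text{if }\mathrm{test}(x)\text{ then }x\text{ else }\operatorname{nestuntil}(\mathrm{test},f)(f(x))$; i.e. starting from $x$, apply $f$ repeatedly (zero or more times) until the test holds and return the resulting value. Cancellation: if $F:P+E\Rrightarrow Q+E$ is a matching of finite sets (the two copies of $E$ being identified), then $\operatorname{cancel}(E,F):P\Rrightarrow Q$ is the matching sending $p$ to the first element outside the summand $E$ among $F(p),F(F(p)),\dots$. A signed set is an ordered pair $A=\langle A^+,A^-\rangle$ of finite sets; $|A|=A^+ + A^-$; $0=\langle\emptyset,\emptyset\rangle$. An unsigned (finite) set $S$ is identified with $\langle S,\emptyset\rangle$; $A\ge0$ means $A$ is unsigned. Operations: $A+B=\langle A^+ + B^+,A^- + B^-\rangle$, $-A=\langle A^-,A^+\rangle$, $A-B=A+(-B)$; sums are commutative and associative with unit $0$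 up to the usual identifications. For $A\subset X$, $A+(X\setminus A)$ is identified with $X$ in the obvious way. A cobordism $f:A\Rrightarrow B$ of signed sets is a triple $(|f|,A,B)$ where $|f|:A^+ + B^-\Rrightarrow A^- + B^+$ is a matching; when $A,B\ge 0$ the cobordism $f$ is identified with the matching $|f|:A\Rrightarrow B$. Composition (natural order): for $f:A\Rrightarrow B$, $g:B\Rrightarrow C$, the cobordism $f\triangleleft g:A\Rrightarrow C$ has $|f\triangleleft g|=\operatorname{cancel}(|B|,|f|+|g|)$, where $|f|+|g|: A^+ + |B| + C^-\Rrightarrow A^- + |B| + C^+$ is the disjoint union. Arithmetic of cobordisms: for $f:A\Rrightarrow B$ and $g:C\Rrightarrow D$, $f+g:A+C\Rrightarrow B+D$ has $|f+g|=|f|+|g|$ (disjoint union of matchings); $-f:-B\Rrightarrow -A$ has $|-f|=|f|$; $f-g=f+(-g)$. The identity $\operatorname{id}(A):A\Rrightarrow A$ has $|\operatorname{id}(A)|=\operatorname{id}(|A|)$. For a cobordism $\phi:A\Rrightarrow B$, the creation cobordism $\operatorname{create}(\phi):0\Rrightarrow B-A$ has $|\operatorname{create}(\phi)|=|\phi|:A^+ + B^-\Rrightarrow A^- + B^+$ (noting $(B-A)^-=A^+ + B^-$ and $(B-A)^+=A^- + B^+$); its negative is $-\operatorname{create}(\phi):A-B\Rrightarrow 0$. *)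

theory Defs
  imports Main "HOL-Library.While_Combinator"
begin

text \<open>
  Disjoint unions are the library's \<^term>\<open>A <+> B\<close> on sum types. The identifications that are
  left implicit on paper (commutativity, associativity, unit, and \<open>A + (X - A)\<close> versus \<open>X\<close>)
  are therefore explicit relabelling functions here.
\<close>

fun swap_sum :: "'a + 'b \<Rightarrow> 'b + 'a" where
  "swap_sum (Inl a) = Inr a"
| "swap_sum (Inr b) = Inl b"

fun interchange :: "('a + 'b) + ('c + 'd) \<Rightarrow> ('a + 'c) + ('b + 'd)" where
  "interchange (Inl (Inl a)) = Inl (Inl a)"
| "interchange (Inl (Inr b)) = Inr (Inl b)"
| "interchange (Inr (Inl c)) = Inl (Inr c)"
| "interchange (Inr (Inr d)) = Inr (Inr d)"

definition matching :: "('p \<Rightarrow> 'q) \<Rightarrow> 'p set \<Rightarrow> 'q set \<Rightarrow> bool" where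
  "matching f P Q \<longleftrightarrow> finite P \<and> finite Q \<and> bij_betw f P Q"

text \<open>The value is \<^const>\<open>None\<close> if the test never succeeds.\<close>

definition nestuntil :: "('a \<Rightarrow> bool) \<Rightarrow> ('a \<Rightarrow> 'a) \<Rightarrow> 'a \<Rightarrow> 'a option" where
  "nestuntil test f = while_option (\<lambda>x. \<not> test x) f"

lemma nestuntil_unfold:
  "nestuntil test f x = (if test x then Some x else nestuntil test f (f x))"
  unfolding nestuntil_def by (subst while_option_unfold) simp

text \<open>
  For \<open>F : P + E \<Rightarrow> Q + E\<close>, with \<open>E\<close> the right summand on both sides. The result of the iteration
  lies outside \<open>E\<close>, hence in the left summand \<open>Q\<close>.
\<close>

definition cancel :: "'e set \<Rightarrow> ('p + 'e \<Rightarrow> 'q + 'e) \<Rightarrow> 'p \<Rightarrow> 'q" where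
  "cancel E F p =
     projl (the (nestuntil (\<lambda>z. z \<notin> Inr ` E) (\<lambda>z. F (Inr (projr z))) (F (Inl p))))"

datatype 'a signed_set = Signed (pos: "'a set") (neg: "'a set")

definition finite_signed :: "'a signed_set \<Rightarrow> bool" where
  "finite_signed A \<longleftrightarrow> finite (pos A) \<and> finite (neg A)"

definition unsigned :: "'a set \<Rightarrow> 'a signed_set" where
  "unsigned S = Signed S {}"

definition abs_signed :: "'a signed_set \<Rightarrow> ('a + 'a) set" where
  "abs_signed A = pos A <+> neg A"

definition zero_signed :: "unit signed_set" where
  "zero_signed = Signed {} {}"

definition add_signed :: "'a signed_set \<Rightarrow> 'b signed_set \<Rightarrow> ('a + 'b) signed_set" where
  "add_signed A B = Signed (pos A <+> pos B) (neg A <+> neg B)"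

definition minus_signed :: "'a signed_set \<Rightarrow> 'a signed_set" where
  "minus_signed A = Signed (neg A) (pos A)"

definition diff_signed :: "'a signed_set \<Rightarrow> 'b signed_set \<Rightarrow> ('a + 'b) signed_set" where
  "diff_signed A B = add_signed A (minus_signed B)"

definition image_signed :: "('a \<Rightarrow> 'b) \<Rightarrow> 'a signed_set \<Rightarrow> 'b signed_set" where
  "image_signed i A = Signed (i ` pos A) (i ` neg A)"

definition identifies :: "('a \<Rightarrow> 'b) \<Rightarrow> 'a signed_set \<Rightarrow> 'b signed_set \<Rightarrow> bool" where
  "identifies i A B \<longleftrightarrow> inj_on i (pos A) \<and> inj_on i (neg A) \<and> image_signed i A = B"

text \<open>
  The underlying matching of \<open>f : A \<Rightarrow> B\<close> goes from \<open>pos A <+> neg B\<close> to \<open>neg A <+> pos B\<close>, so that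
  the left summand always belongs to the source and the right summand to the target. Its values
  outside \<open>pos A <+> neg B\<close> are irrelevant.
\<close>

datatype ('a, 'b) cob =
  Cob (mat: "'a + 'b \<Rightarrow> 'a + 'b") (src: "'a signed_set") (tgt: "'b signed_set")

definition cobordism :: "('a, 'b) cob \<Rightarrow> 'a signed_set \<Rightarrow> 'b signed_set \<Rightarrow> bool" where
  "cobordism f A B \<longleftrightarrow> src f = A \<and> tgt f = B \<and> finite_signed A \<and> finite_signed B \<and>
     matching (mat f) (pos A <+> neg B) (neg A <+> pos B)"

text \<open>The identification of cobordisms between unsigned sets with matchings, in both directions.\<close>

definition cob_of_matching :: "('a \<Rightarrow> 'b) \<Rightarrow> 'a set \<Rightarrow> 'b set \<Rightarrow> ('a, 'b) cob" where
  "cob_of_matching f P Q = Cob (\<lambda>z. Inr (f (projl z))) (unsigned P) (unsigned Q)"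

definition matching_of_cob :: "('a, 'b) cob \<Rightarrow> 'a \<Rightarrow> 'b" where
  "matching_of_cob f a = projr (mat f (Inl a))"

text \<open>
  \<open>regroup_in\<close> and \<open>regroup_out\<close> rearrange the source and the target of \<open>|f| + |g|\<close>, for
  \<open>f : A \<Rightarrow> B\<close> and \<open>g : B \<Rightarrow> C\<close>:
  \<open>(pos A + neg C) + (pos B + neg B)\<close> into \<open>(pos A + neg B) + (pos B + neg C)\<close>, and
  \<open>(neg A + pos B) + (neg B + pos C)\<close> into \<open>(neg A + pos C) + (pos B + neg B)\<close>.
\<close>

fun regroup_in :: "('a + 'c) + ('b + 'b) \<Rightarrow> ('a + 'b) + ('b + 'c)" where
  "regroup_in (Inl (Inl a)) = Inl (Inl a)"
| "regroup_in (Inl (Inr c)) = Inr (Inr c)"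
| "regroup_in (Inr (Inl b)) = Inr (Inl b)"
| "regroup_in (Inr (Inr b)) = Inl (Inr b)"

fun regroup_out :: "('a + 'b) + ('b + 'c) \<Rightarrow> ('a + 'c) + ('b + 'b)" where
  "regroup_out (Inl (Inl a)) = Inl (Inl a)"
| "regroup_out (Inl (Inr b)) = Inr (Inl b)"
| "regroup_out (Inr (Inl b)) = Inr (Inr b)"
| "regroup_out (Inr (Inr c)) = Inl (Inr c)"

definition cob_comp :: "('a, 'b) cob \<Rightarrow> ('b, 'c) cob \<Rightarrow> ('a, 'c) cob" where
  "cob_comp f g =
     Cob (cancel (abs_signed (tgt f)) (regroup_out \<circ> map_sum (mat f) (mat g) \<circ> regroup_in))
       (src f) (tgt g)"

definition cob_add :: "('a, 'b) cob \<Rightarrow> ('c, 'd) cob \<Rightarrow> ('a + 'c, 'b + 'd) cob" where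
  "cob_add f g =
     Cob (interchange \<circ> map_sum (mat f) (mat g) \<circ> interchange)
       (add_signed (src f) (src g)) (add_signed (tgt f) (tgt g))"

definition cob_minus :: "('a, 'b) cob \<Rightarrow> ('b, 'a) cob" where
  "cob_minus f =
     Cob (swap_sum \<circ> mat f \<circ> swap_sum) (minus_signed (tgt f)) (minus_signed (src f))"

definition cob_diff :: "('a, 'b) cob \<Rightarrow> ('c, 'd) cob \<Rightarrow> ('a + 'd, 'b + 'c) cob" where
  "cob_diff f g = cob_add f (cob_minus g)"

text \<open>
  The matching \<open>id(|A|)\<close> is read from \<open>pos A <+> neg A\<close> to \<open>neg A <+> pos A\<close>, where it is the
  exchange of the summands.
\<close>

definition cob_id :: "'a signed_set \<Rightarrow> ('a, 'a) cob" where
  "cob_id A = Cob swap_sum A A"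

definition create :: "('a, 'b) cob \<Rightarrow> (unit, 'b + 'a) cob" where
  "create \<phi> =
     Cob (\<lambda>z. Inr (swap_sum (mat \<phi> (swap_sum (projr z)))))
       zero_signed (diff_signed (tgt \<phi>) (src \<phi>))"

text \<open>
  Transport of a cobordism along identifications \<open>i\<close> of its source and \<open>j\<close> of its target; the
  maps need only be injective on the positive and on the negative part separately.
\<close>

definition relabel :: "('a \<Rightarrow> 'c) \<Rightarrow> ('b \<Rightarrow> 'd) \<Rightarrow> ('a, 'b) cob \<Rightarrow> ('c, 'd) cob" where
  "relabel i j f =
     Cob (map_sum i j \<circ> mat f \<circ> map_sum (inv_into (pos (src f)) i) (inv_into (neg (tgt f)) j))
       (image_signed i (src f)) (image_signed j (tgt f))"

text \<open>The identifications \<open>A + ((X - A) - Y) = X - Y\<close> and \<open>B + -(Y - (X - B)) = X - Y\<close>.\<close>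

definition ident_target :: "'x + ('x + 'y) \<Rightarrow> 'x + 'y" where
  "ident_target = case_sum Inl id"

definition ident_source :: "'x + ('y + 'x) \<Rightarrow> 'x + 'y" where
  "ident_source = case_sum Inl swap_sum"

lemmas signed_defs = unsigned_def zero_signed_def add_signed_def minus_signed_def
  diff_signed_def image_signed_def

lemma identifies_unit:
  "identifies projl (add_signed A zero_signed) A"
  "identifies projl (add_signed A (minus_signed zero_signed)) A"
  by (cases A; force simp: identifies_def signed_defs inj_on_def)+

lemma identifies_ident_target:
  assumes "A \<subseteq> X"
  shows "identifies ident_target
    (add_signed (unsigned A) (diff_signed (unsigned (X - A)) (unsigned Y)))
    (diff_signed (unsigned X) (unsigned Y))"
  using assms
  by (auto simp: identifies_def signed_defs ident_target_def inj_on_def Plus_def image_Un image_image)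

lemma identifies_ident_source:
  assumes "B \<subseteq> X"
  shows "identifies ident_source
    (add_signed (unsigned B) (minus_signed (diff_signed (unsigned Y) (unsigned (X - B)))))
    (diff_signed (unsigned X) (unsigned Y))"
  using assms
  by (auto simp: identifies_def signed_defs ident_source_def inj_on_def Plus_def image_Un image_image)

end

theory Submission
  imports Defs
begin

text \<open>
  Unwinding the relabellings, the cancelled matching sends \<open>a \<in> A\<close> into the summand \<open>X\<close> of \<open>|X - Y|\<close>;
  there \<open>x \<in> B\<close> leaves towards the target, while \<open>x \<in> X - B\<close> goes to \<open>\<psi> x \<in> Y\<close> and then back to
  \<open>\<phi> (\<psi> x) \<in> X\<close>. Hence \<open>h\<close> iterates the bijection \<open>T = \<phi> \<circ> \<psi>\<close> from \<open>X - B\<close> to \<open>X - A\<close> until \<open>B\<close> is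
  reached. Since no value of \<open>T\<close> lies in \<open>A\<close>, two orbits starting in \<open>A\<close> cannot meet and no orbit
  meets itself; finiteness of \<open>X\<close> then gives termination.
\<close>

lemma nestuntil_eq_None_iff:
  "nestuntil test f x = None \<longleftrightarrow> (\<forall>k. \<not> test ((f ^^ k) x))"
  by (auto simp: nestuntil_def while_option_def)

text \<open>The minimality of \<open>k\<close> is kept because the orbit lemmas below need every
  earlier iterate to lie outside \<open>B\<close>.\<close>

lemma nestuntil_eq_SomeE:
  assumes "nestuntil test f x = Some y"
  obtains k where "y = (f ^^ k) x" "test y" "\<And>i. i < k \<Longrightarrow> \<not> test ((f ^^ i) x)"
proof -
  define k where "k = (LEAST k. test ((f ^^ k) x))"
  have ex: "\<exists>k. test ((f ^^ k) x)" and y: "y = (f ^^ k) x"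
    using assms by (auto simp: nestuntil_def while_option_def k_def split: if_splits)
  moreover have "test y"
    unfolding y k_def using ex by (rule LeastI_ex)
  ultimately show thesis
    using that[of k] not_less_Least unfolding k_def by blast
qed

context
  fixes T :: "'a \<Rightarrow> 'a" and X A B :: "'a set"
  assumes sub: "A \<subseteq> X" "B \<subseteq> X" and bij: "bij_betw T (X - B) (X - A)"
begin

lemma funpow_mem_before_exit:
  assumes "a \<in> A" and "\<And>i. i < k \<Longrightarrow> (T ^^ i) a \<notin> B"
  shows "(T ^^ k) a \<in> X"
  using assms
proof (induction k)
  case 0
  then show ?case using sub by auto
next
  case (Suc k)
  then have "(T ^^ k) a \<in> X - B" by simp
  then show ?case using bij_betwE[OF bij] by auto
qed

text \<open>Injectivity of \<open>T\<close> on \<open>X - B\<close> strips one \<open>T\<close> from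
  both sides until an exponent is 0. The other must then be 0 as well, since a value of
  \<open>T\<close> never lies in \<open>A\<close>. With \<open>a' = a\<close> this gives
  termination, with arbitrary \<open>a'\<close> injectivity of the exit map.\<close>

lemma funpow_eq_before_exit:
  assumes "a \<in> A" "a' \<in> A" and "(T ^^ k) a = (T ^^ l) a'"
    and "\<And>i. i < k \<Longrightarrow> (T ^^ i) a \<notin> B" and "\<And>i. i < l \<Longrightarrow> (T ^^ i) a' \<notin> B"
  shows "k = l \<and> a = a'"
  using assms
proof (induction k arbitrary: l)
  case 0
  show ?case
  proof (cases l)
    case (Suc m)
    then have "(T ^^ m) a' \<in> X - B"
      using 0 funpow_mem_before_exit[of a' m] by auto
    then have "T ((T ^^ m) a') \<notin> A"
      using bij_betwE[OF bij] by auto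
    then show ?thesis using 0 Suc by auto
  qed (use 0 in auto)
next
  case (Suc k)
  have k: "(T ^^ k) a \<in> X - B"
    using Suc funpow_mem_before_exit[of a k] by auto
  show ?case
  proof (cases l)
    case 0
    have "T ((T ^^ k) a) \<notin> A"
      using k bij_betwE[OF bij] by auto
    then show ?thesis using Suc 0 by auto
  next
    case l: (Suc m)
    have "(T ^^ m) a' \<in> X - B"
      using Suc l funpow_mem_before_exit[of a' m] by auto
    then have "(T ^^ k) a = (T ^^ m) a'"
      using k Suc.prems(3) l bij_betw_imp_inj_on[OF bij] by (auto dest: inj_onD)
    then have "k = m \<and> a = a'"
      using Suc.IH[of m] Suc.prems l by auto
    then show ?thesis using l by simp
  qed
qed

lemma nestuntil_terminates:
  assumes "finite X" "a \<in> A"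
  shows "\<exists>b\<in>B. nestuntil (\<lambda>x. x \<in> B) T a = Some b"
proof (cases "nestuntil (\<lambda>x. x \<in> B) T a")
  case None
  then have "(T ^^ k) a \<notin> B" for k
    by (simp add: nestuntil_eq_None_iff)
  \<comment> \<open>An orbit that never reaches \<open>B\<close> would embed the naturals into the
    finite set \<open>X\<close>.\<close>
  then have "inj (\<lambda>k. (T ^^ k) a)" and "range (\<lambda>k. (T ^^ k) a) \<subseteq> X"
    using assms funpow_eq_before_exit funpow_mem_before_exit by (blast intro: injI)+
  then show ?thesis
    using \<open>finite X\<close> by (meson finite_imageD finite_subset infinite_UNIV_nat)
qed (auto elim: nestuntil_eq_SomeE)

lemma bij_betw_nestuntil:
  assumes "finite X"
  shows "bij_betw (\<lambda>a. the (nestuntil (\<lambda>x. x \<in> B) T a)) A B" (is "bij_betw ?h A B")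
proof -
  have fin: "finite A" "finite B"
    using sub \<open>finite X\<close> finite_subset by auto
  \<comment> \<open>Surjectivity comes by counting: \<open>T\<close> forces \<open>A\<close> and
    \<open>B\<close> to have equal size, so an injection from \<open>A\<close> into \<open>B\<close>
    is onto.\<close>
  have "card (X - A) = card (X - B)"
    using bij_betw_same_card[OF bij] by simp
  then have card: "card A = card B"
    using card_Diff_subset[of A X] card_Diff_subset[of B X] card_mono[of X A] card_mono[of X B]
      fin sub \<open>finite X\<close> by linarith
  have inj: "inj_on ?h A"
  proof (rule inj_onI)
    fix a a' assume a: "a \<in> A" "a' \<in> A" and eq: "?h a = ?h a'"
    obtain b where b: "nestuntil (\<lambda>x. x \<in> B) T a = Some b"
      using nestuntil_terminates[OF \<open>finite X\<close> a(1)] by auto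
    obtain b' where b': "nestuntil (\<lambda>x. x \<in> B) T a' = Some b'"
      using nestuntil_terminates[OF \<open>finite X\<close> a(2)] by auto
    have "b = b'" using eq b b' by simp
    from b obtain k where k: "b = (T ^^ k) a" "\<And>i. i < k \<Longrightarrow> (T ^^ i) a \<notin> B"
      by (rule nestuntil_eq_SomeE) blast
    from b' obtain l where l: "b' = (T ^^ l) a'" "\<And>i. i < l \<Longrightarrow> (T ^^ i) a' \<notin> B"
      by (rule nestuntil_eq_SomeE) blast
    show "a = a'"
      using funpow_eq_before_exit[OF a, of k l] k l \<open>b = b'\<close> by auto
  qed
  moreover have "?h ` A \<subseteq> B"
    using nestuntil_terminates[OF \<open>finite X\<close>] by fastforce
  ultimately have "?h ` A = B"
    using card fin by (simp add: card_image card_subset_eq)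
  with inj show ?thesis
    by (simp add: bij_betw_def)
qed

end

lemma inv_into_identifies:
  assumes "identifies i A B"
  shows "a \<in> pos A \<Longrightarrow> inv_into (pos A) i (i a) = a"
    and "a \<in> neg A \<Longrightarrow> inv_into (neg A) i (i a) = a"
  using assms by (simp_all add: identifies_def)

lemma image_identifies: "identifies i A B \<Longrightarrow> image_signed i A = B"
  by (simp add: identifies_def)

text \<open>Presenting the argument as \<open>i a\<close> with \<open>a\<close> in the positive part
  of the source undoes the \<open>inv_into\<close> hidden in \<open>relabel\<close>.\<close>

lemma mat_relabel_Inl:
  assumes "identifies i (src f) C" "a \<in> pos (src f)"
  shows "mat (relabel i j f) (Inl (i a)) = map_sum i j (mat f (Inl a))"
  using assms by (simp add: relabel_def inv_into_identifies)

lemma mat_relabel_Inr: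
  assumes "identifies j (tgt f) D" "b \<in> neg (tgt f)"
  shows "mat (relabel i j f) (Inr (j b)) = map_sum i j (mat f (Inr b))"
  using assms by (simp add: relabel_def inv_into_identifies)

theorem corollary7:
  fixes X A B :: "'x set" and Y :: "'y set"
    and \<phi> :: "'y \<Rightarrow> 'x" and \<psi> :: "'x \<Rightarrow> 'y"
    and h :: "('x, 'x) cob"
  assumes "finite X" and "finite Y" and "A \<subseteq> X" and "B \<subseteq> X"
    and "matching \<phi> Y (X - A)" and "matching \<psi> (X - B) Y"
  defines "h \<equiv> cob_comp
      (relabel projl ident_target
        (cob_add (cob_id (unsigned A)) (create (cob_of_matching \<phi> Y (X - A)))))
      (relabel ident_source projl
        (cob_diff (cob_id (unsigned B)) (create (cob_of_matching \<psi> (X - B) Y))))"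
  shows "cobordism h (unsigned A) (unsigned B)
    \<and> matching (matching_of_cob h) A B
    \<and> (\<forall>a\<in>A. nestuntil (\<lambda>x. x \<in> B) (\<lambda>x. \<phi> (\<psi> x)) a = Some (matching_of_cob h a))"
proof -
  define f where "f = cob_add (cob_id (unsigned A)) (create (cob_of_matching \<phi> Y (X - A)))"
  define g where "g = cob_diff (cob_id (unsigned B)) (create (cob_of_matching \<psi> (X - B) Y))"
  let ?f = "relabel projl ident_target f" and ?g = "relabel ident_source projl g"
  define T where "T = (\<lambda>x. \<phi> (\<psi> x))"
  have h: "h = cob_comp ?f ?g"
    by (simp add: h_def f_def g_def)
  have bij: "bij_betw T (X - B) (X - A)"
    using bij_betw_trans[of \<psi> "X - B" Y \<phi> "X - A"] assms(5,6)
    by (simp add: matching_def T_def comp_def)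
  have \<psi>: "\<psi> x \<in> Y" if "x \<in> X - B" for x
    using assms(6) that by (auto simp: matching_def dest: bij_betwE)

  have src_f: "src f = add_signed (unsigned A) zero_signed"
    and tgt_f: "tgt f = add_signed (unsigned A) (diff_signed (unsigned (X - A)) (unsigned Y))"
    and src_g: "src g = add_signed (unsigned B)
      (minus_signed (diff_signed (unsigned Y) (unsigned (X - B))))"
    and tgt_g: "tgt g = add_signed (unsigned B) (minus_signed zero_signed)"
    by (simp_all add: f_def g_def cob_add_def cob_diff_def cob_minus_def cob_id_def create_def
        cob_of_matching_def)
  have id_src_f: "identifies projl (src f) (unsigned A)"
    and id_tgt_f: "identifies ident_target (tgt f) (diff_signed (unsigned X) (unsigned Y))"
    and id_src_g: "identifies ident_source (src g) (diff_signed (unsigned X) (unsigned Y))"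
    and id_tgt_g: "identifies projl (tgt g) (unsigned B)"
    unfolding src_f tgt_f src_g tgt_g
    using identifies_unit identifies_ident_target identifies_ident_source assms(3,4) by auto

  have mat_f: "mat f (Inl (Inl a)) = Inr (Inl a)" "mat f (Inr (Inr (Inr y))) = Inr (Inr (Inl (\<phi> y)))"
    and mat_g: "mat g (Inl (Inl x)) = Inr (Inl x)" "mat g (Inl (Inr (Inr x))) = Inl (Inr (Inl (\<psi> x)))"
    for a x y
    by (simp_all add: f_def g_def cob_add_def cob_diff_def cob_minus_def cob_id_def create_def
        cob_of_matching_def)
  have f_A: "mat ?f (Inl a) = Inr (Inl a)" if "a \<in> A" for a
    using mat_relabel_Inl[OF id_src_f, of "Inl a" ident_target] that
    by (simp add: src_f signed_defs InlI mat_f ident_target_def)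
  have f_Y: "mat ?f (Inr (Inr y)) = Inr (Inl (\<phi> y))" if "y \<in> Y" for y
    using mat_relabel_Inr[OF id_tgt_f, of "Inr (Inr y)" projl] that
    by (simp add: tgt_f signed_defs InrI mat_f ident_target_def)
  \<comment> \<open>\<open>ident_source\<close> maps both \<open>Inl x\<close> and
    \<open>Inr (Inr x)\<close> to \<open>Inl x\<close>. Only one of them lies in the positive part
    of \<open>src g\<close>, depending on whether \<open>x\<close> is in \<open>B\<close>; this is
    the origin of the test of \<open>nestuntil\<close>.\<close>
  have g_B: "mat ?g (Inl (Inl x)) = Inr x" if "x \<in> B" for x
    using mat_relabel_Inl[OF id_src_g, of "Inl x" projl] that
    by (simp add: src_g signed_defs InlI mat_g ident_source_def)
  have g_X: "mat ?g (Inl (Inl x)) = Inl (Inr (\<psi> x))" if "x \<in> X - B" for x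
    using mat_relabel_Inl[OF id_src_g, of "Inr (Inr x)" projl] that
    by (simp add: src_g signed_defs InrI mat_g ident_source_def)

  have tgt: "tgt ?f = diff_signed (unsigned X) (unsigned Y)"
    using image_identifies[OF id_tgt_f] by (simp add: relabel_def)
  have src_h: "src h = unsigned A" and tgt_h: "tgt h = unsigned B"
    using image_identifies[OF id_src_f] image_identifies[OF id_tgt_g]
    by (simp_all add: h cob_comp_def relabel_def)

  define E where "E = abs_signed (diff_signed (unsigned X) (unsigned Y))"
  have E: "Inl (Inl x) \<in> E \<longleftrightarrow> x \<in> X" "Inr (Inr y) \<in> E \<longleftrightarrow> y \<in> Y" for x y
    by (auto simp: E_def abs_signed_def signed_defs)
  define F where "F = regroup_out \<circ> map_sum (mat ?f) (mat ?g) \<circ> regroup_in"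
  let ?iter = "nestuntil (\<lambda>z. z \<notin> Inr ` E) (\<lambda>z. F (Inr (projr z)))"
  have mat_h: "mat h = cancel E F"
    by (simp add: h cob_comp_def tgt E_def F_def)
  have F_A: "F (Inl (Inl a)) = Inr (Inl (Inl a))" if "a \<in> A" for a
    using that by (simp add: F_def f_A)
  have iter_B: "?iter (Inr (Inl (Inl x))) = Some (Inl (Inr x))" if "x \<in> B" for x
    using that assms(4)
    by (subst nestuntil_unfold, subst nestuntil_unfold) (auto simp: F_def g_B E image_iff)
  \<comment> \<open>One step of \<open>T\<close> is two steps of \<open>F\<close>: \<open>g\<close>
    moves \<open>x\<close> to \<open>\<psi> x\<close> in \<open>Y\<close>, still inside
    \<open>E\<close>, and \<open>f\<close> moves that to \<open>\<phi> (\<psi> x)\<close>. Hence two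
    unfoldings; in \<open>iter_B\<close> the second one is the exit test.\<close>
  have iter_X: "?iter (Inr (Inl (Inl x))) = ?iter (Inr (Inl (Inl (T x))))" if "x \<in> X - B" for x
    using that \<psi>[OF that]
    by (subst nestuntil_unfold, subst nestuntil_unfold)
      (auto simp: F_def g_X f_Y E image_iff T_def)

  have mat_h_A: "mat h (Inl a) = Inr b"
    if "a \<in> A" and b: "nestuntil (\<lambda>x. x \<in> B) T a = Some b" for a b
  proof -
    have "b \<in> B" using b by (rule nestuntil_eq_SomeE)
    \<comment> \<open>Loop invariant of the iteration of \<open>T\<close>: the current point lies in
      \<open>X\<close>, and the cancellation started from it has the same outcome as from
      \<open>a\<close>.\<close>
    have "b \<in> X \<and> ?iter (Inr (Inl (Inl a))) = ?iter (Inr (Inl (Inl b)))"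
      by (rule while_option_rule[OF _ b[unfolded nestuntil_def]])
        (use that(1) assms(3) iter_X bij_betwE[OF bij] in auto)
    then show ?thesis
      using \<open>b \<in> B\<close> \<open>a \<in> A\<close> by (simp add: mat_h cancel_def F_A iter_B)
  qed
  have mat_h_nest: "mat h (Inl a) = Inr (matching_of_cob h a)"
    and nest: "nestuntil (\<lambda>x. x \<in> B) T a = Some (matching_of_cob h a)" if "a \<in> A" for a
    using nestuntil_terminates[OF assms(3,4) bij assms(1) that] mat_h_A[OF that]
    by (auto simp: matching_of_cob_def)
  have fin: "finite A" "finite B"
    using assms(1,3,4) finite_subset by auto
  have bij_h: "bij_betw (matching_of_cob h) A B"
    using bij_betw_nestuntil[OF assms(3,4) bij assms(1)]
    by (rule bij_betw_cong[THEN iffD1, rotated]) (simp add: nest)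
  \<comment> \<open>As \<open>A\<close> and \<open>B\<close> have empty negative parts,
    \<open>mat h\<close> only exchanges the summand of the source for that of the target.\<close>
  then have "bij_betw (mat h) (A <+> {}) ({} <+> B)"
    by (force simp: bij_betw_def inj_on_def mat_h_nest Plus_def image_image)
  then have "cobordism h (unsigned A) (unsigned B)"
    using fin src_h tgt_h
    by (simp add: cobordism_def finite_signed_def matching_def unsigned_def)
  then show ?thesis
    using bij_h fin nest by (simp add: matching_def T_def)
qed

end
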